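(* For each integer $n\ge 0$, $$\overline{SOME}(3n+2)\equiv 0\pmod 3,$$ $$\overline{SOME}(24n+19)\equiv 0\pmod 3.$$
   Context: An overpartition of a nonnegative integer $n$ is a partition of $n$ in which the first occurrence of each distinct part may be overlined (or not). For $n\ge 0$, $\overline{SOME}(n)$ denotes the sum, over all overpartitions $\lambda$ of $n$, of (the sum of the odd parts of $\lambda$) minus (the sum of the even parts of $\lambda$), where parts are counted with multiplicity and an overlined part counts with its numerical size. *)

theory Defs
  imports "HOL-Library.Multiset" "HOL-Number_Theory.Cong"
begin

(* An overpartition is encoded as a pair (M, S): M is the multiset of the numerical sizes of
   its parts, and S is the set of those sizes whose first occurrence is overlined.  Since at most
   one occurrence of each size can be overlined, this loses nothing. *)
definition overpartitions :: "nat \<Rightarrow> (nat multiset \<times> nat set) set" where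
  "overpartitions n = {(M, S). 0 \<notin># M \<and> sum_mset M = n \<and> S \<subseteq> set_mset M}"

definition odd_parts_sum :: "nat multiset \<times> nat set \<Rightarrow> nat" where
  "odd_parts_sum l = sum_mset (filter_mset odd (fst l))"

definition even_parts_sum :: "nat multiset \<times> nat set \<Rightarrow> nat" where
  "even_parts_sum l = sum_mset (filter_mset even (fst l))"

definition SOME_bar :: "nat \<Rightarrow> int" where
  "SOME_bar n = (\<Sum>l\<in>overpartitions n. int (odd_parts_sum l) - int (even_parts_sum l))"

(* The sum in SOME_bar is a genuine finite sum. *)
lemma finite_overpartitions: "finite (overpartitions n)"
proof -
  have size_le: "size M \<le> sum_mset M" if "0 \<notin># M" for M :: "nat multiset"
    using that by (induction M) auto
  have "M \<in> mset ` {xs. set xs \<subseteq> {..n} \<and> length xs \<le> n}"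
    if M: "0 \<notin># M" "sum_mset M = n" for M
  proof -
    obtain xs where xs: "mset xs = M" using ex_mset by blast
    have "length xs \<le> n" using size_le[OF M(1)] M(2) xs by auto
    moreover have "x \<le> n" if "x \<in> set xs" for x
      using that xs M(2) by (metis elem_le_sum_list in_set_conv_nth sum_mset_sum_list)
    ultimately show ?thesis using xs by auto
  qed
  then have "overpartitions n \<subseteq>
      mset ` {xs. set xs \<subseteq> {..n} \<and> length xs \<le> n} \<times> Pow {..n}"
    unfolding overpartitions_def by fastforce
  then show ?thesis
    by (rule finite_subset) (simp add: finite_lists_length_le)
qed

end

theory Submission
  imports Defs "HOL-Computational_Algebra.Formal_Power_Series"
begin

text \<open>
  Let \<open>S(q)\<close> be the generating function of \<open>SOME_bar\<close>, \<open>P(q)\<close> that of the number of overpartitions,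
  \<open>\<phi>(q)\<close> the sum of \<open>q^(x^2)\<close> over all integers \<open>x\<close>, and \<open>\<psi>(q) = \<phi>(-q^2)\<close>.  The heart of the proof is
  the identity \<open>S(q) \<psi>(q)^2 = q \<phi>'(q)\<close> (lemma \<open>SOME_bar_mult_psi\<close>).  It has three sources.

  First, a sum over overpartitions of a statistic that is additive in the parts is \<open>P\<close> times a
  Lambert series (\<open>overpart_gf_additive\<close>).  For the signed part size this gives \<open>S = 2 A P\<close>, and for
  the part size itself \<open>q P' = 2 L P\<close>, where \<open>A(q) = -L(-q)\<close>.  Second, an identity in the style of
  Liouville, proved by involutions on the solutions of \<open>i^2 + d e = n\<close>, says \<open>2 A \<phi> = q \<phi>'\<close>
  (\<open>lambert_series_mult_phi\<close>).  Replacing \<open>q\<close> by \<open>-q\<close> turns it into the differential equation of \<open>1/P\<close>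
  for \<open>\<phi>(-q)\<close>, so \<open>P(q) \<phi>(-q) = 1\<close>, which is Gauss's identity, without any infinite product.
  Third, \<open>\<phi>(q) \<phi>(-q) = \<psi>(q)^2\<close>, because the pairs \<open>(x, y)\<close> of opposite parity cancel and the others
  are \<open>(u + v, u - v)\<close>.

  Now put \<open>Q = 1/\<psi>\<close> and \<open>T = q \<phi>'\<close>.  Then
  \<open>S = T Q^2 = T \<psi> Q^3 = T (\<psi> - \<psi>^9) Q^3 + T \<psi>^6\<close>,
  and it remains to see which exponents occur modulo 3.  The Frobenius congruence
  \<open>F(q)^3 \<equiv> F(q^3)\<close> shows that \<open>Q^3\<close> has exponents divisible by 3, that \<open>\<psi>^9\<close> is the part of \<open>\<psi>\<close> with
  exponents divisible by 3, so that the difference has exponents \<open>2 y^2 \<equiv> 2\<close>, and that the exponents of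
  \<open>\<psi>^6\<close> are of the form \<open>6 (u^2 + v^2)\<close>.  In \<open>T\<close> the coefficient of \<open>q^(x^2)\<close> is a multiple of
  \<open>x^2\<close>, which leaves exponents \<open>x^2 \<equiv> 1\<close>.  So the first summand lives in the residue class 0 and the
  second in the class 1, more precisely on numbers \<open>x^2 + 6 (u^2 + v^2)\<close>.  Class 2 is empty, and
  numbers \<open>24 n + 19\<close> lie in class 1 but are 3 modulo 8, which \<open>x^2 + 6 (u^2 + v^2)\<close> never is.
\<close>

unbundle fps_syntax

section \<open>A sum over representations as a square plus a product\<close>

definition parity_sign :: "int \<Rightarrow> int" where
  "parity_sign x = (if even x then 1 else - 1)"

lemma sum_sign_reversing_involution:
  fixes f :: "'a \<Rightarrow> int"
  assumes "\<And>a. a \<in> X \<Longrightarrow> h a \<in> X" "\<And>a. a \<in> X \<Longrightarrow> h (h a) = a"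
    "\<And>a. a \<in> X \<Longrightarrow> f (h a) = - f a"
  shows "sum f X = 0"
proof -
  have "sum f X = (\<Sum>a\<in>X. - f a)"
    by (rule sum.reindex_bij_witness[of _ h h]) (use assms in auto)
  then show ?thesis by (simp add: sum_negf)
qed

lemma abs_le_square: "\<bar>x\<bar> \<le> x\<^sup>2" for x :: int
proof (cases "x = 0")
  case False
  then have "\<bar>x\<bar> * 1 \<le> \<bar>x\<bar> * \<bar>x\<bar>" by (intro mult_left_mono) simp_all
  then show ?thesis by (simp add: power2_eq_square)
qed simp

lemma finite_square_plus_product:
  "finite {(i, d, e). i\<^sup>2 + d * e = n \<and> 0 < d \<and> 0 < e}" (is "finite ?X")
  for n :: int
proof (rule finite_subset)
  show "?X \<subseteq> {- n..n} \<times> {0..n} \<times> {0..n}"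
  proof clarify
    fix i d e :: int assume n: "n = i\<^sup>2 + d * e" and "0 < d" "0 < e"
    have "d \<le> d * e" "e \<le> d * e" using \<open>0 < d\<close> \<open>0 < e\<close> by simp_all
    moreover have "\<bar>i\<bar> \<le> i\<^sup>2" by (rule abs_le_square)
    ultimately have "\<bar>i\<bar> \<le> i\<^sup>2 + d * e" "d \<le> i\<^sup>2 + d * e" "e \<le> i\<^sup>2 + d * e"
      using \<open>0 < d\<close> \<open>0 < e\<close> abs_ge_zero[of i] by linarith+
    then show "i \<in> {- (i\<^sup>2 + d * e)..i\<^sup>2 + d * e} \<and> (d, e) \<in> {0..i\<^sup>2 + d * e} \<times> {0..i\<^sup>2 + d * e}"
      using \<open>0 < d\<close> \<open>0 < e\<close> by auto
  qed
qed simp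

text \<open>
  Adding the odd function \<open>i\<close> of \<open>(i, d, e)\<close> to \<open>d\<close> does not change the sum and makes the summand,
  up to sign, a function of \<open>i + d\<close> alone.  The shear \<open>(i, d, e) \<mapsto> (e - i, d + 2 i - e, e)\<close> preserves
  \<open>i^2 + d e\<close> and \<open>i + d\<close> but changes the parity of \<open>d\<close>, so everything with \<open>e < d + 2 i\<close> cancels.  Where
  \<open>e = d + 2 i\<close>, the number \<open>n\<close> is the square of \<open>i + d\<close>; these terms give the right-hand side.  Where
  \<open>d + 2 i < e\<close>, a further shear leads to triples \<open>(j, d, f)\<close> with \<open>d + f\<close> odd, whose sum vanishes by
  symmetry.
\<close>
lemma liouville_square_identity:
  fixes n :: int
  shows "2 * (\<Sum>(i, d, e)\<in>{(i, d, e). i\<^sup>2 + d * e = n \<and> 0 < d \<and> 0 < e \<and> odd e}. - parity_sign d * d)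
       = (\<Sum>x\<in>{x. x\<^sup>2 = n}. x\<^sup>2)"
proof -
  define Om where "Om = {(i, d, e). i\<^sup>2 + d * e = n \<and> 0 < d \<and> 0 < e \<and> odd e}"
  define w where "w = (\<lambda>(i, d, e::int). - parity_sign d * (i + d))"
  have fin: "finite Om"
    by (rule finite_subset[OF _ finite_square_plus_product[of n]]) (auto simp: Om_def)
  define Gt where "Gt = {(i, d, e) \<in> Om. d + 2 * i > e}"
  define Eq where "Eq = {(i, d, e) \<in> Om. d + 2 * i = e}"
  define Lt where "Lt = {(i, d, e) \<in> Om. d + 2 * i < e}"
  have "(\<Sum>(i, d, e)\<in>Om. - parity_sign d * i) = 0"
    by (rule sum_sign_reversing_involution[where h = "\<lambda>(i, d, e). (- i, d, e)"])
      (auto simp: Om_def)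
  then have "(\<Sum>(i, d, e)\<in>Om. - parity_sign d * d) = sum w Om"
    by (simp add: w_def algebra_simps case_prod_unfold sum_subtractf sum_negf)
  also have "sum w Om = sum w Gt + sum w Eq + sum w Lt"
  proof -
    have "Om = Gt \<union> Eq \<union> Lt" "Gt \<inter> Eq = {}" "(Gt \<union> Eq) \<inter> Lt = {}"
      by (auto simp: Gt_def Eq_def Lt_def)
    moreover have "finite Gt" "finite Eq" "finite Lt"
      by (auto intro: finite_subset[OF _ fin] simp: Gt_def Eq_def Lt_def)
    ultimately show ?thesis by (simp add: sum.union_disjoint)
  qed
  also have "sum w Gt = 0"
    by (rule sum_sign_reversing_involution[where h = "\<lambda>(i, d, e). (e - i, d + 2 * i - e, e)"])
      (auto simp: Gt_def Om_def w_def parity_sign_def algebra_simps power2_eq_square)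
  also have "sum w Lt = 0"
  proof -
    define A where "A = {(j, d, f). j\<^sup>2 + d * f = n \<and> 0 < d \<and> 0 < f \<and> odd (d + f)}"
    define A' where "A' = {(j, d, f) \<in> A. 0 < f + 2 * j - d}"
    define A'' where "A'' = {(j, d, f) \<in> A. f + 2 * j - d < 0}"
    define v where "v = (\<lambda>(j, d, f::int). - parity_sign d * j)"
    have finA: "finite A"
      by (rule finite_subset[OF _ finite_square_plus_product[of n]]) (auto simp: A_def)
    \<comment> \<open>The shear has image \<open>A'\<close>.  The swap below carries \<open>A'\<close> to its complement \<open>A''\<close> in \<open>A\<close> without
      changing the summand, so the sum over \<open>A'\<close> is half of that over \<open>A\<close>.  The latter is 0, as the summand is odd in \<open>j\<close>.\<close>
    have "sum w Lt = sum v A'"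
      by (rule sum.reindex_bij_witness[where j = "\<lambda>(i, d, e). (i + d, d, e - 2 * i - d)"
            and i = "\<lambda>(j, d, f). (j - d, d, f + 2 * j - d)"])
        (auto simp: Lt_def Om_def A_def A'_def v_def w_def algebra_simps power2_eq_square)
    moreover have "sum v A' = sum v A''"
      by (rule sum.reindex_bij_witness[where j = "\<lambda>(j, d, f). (- j, f, d)"
            and i = "\<lambda>(j, d, f). (- j, f, d)"])
        (auto simp: A_def A'_def A''_def v_def parity_sign_def algebra_simps)
    moreover have "sum v A = sum v A' + sum v A''"
    proof -
      have "f + 2 * j - d \<noteq> 0" if "odd (d + f)" for j d f :: int
        using that by presburger
      then have "A = A' \<union> A''" by (fastforce simp: A_def A'_def A''_def)
      moreover have "A' \<inter> A'' = {}" by (auto simp: A'_def A''_def)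
      moreover have "finite A'" "finite A''"
        by (auto intro: finite_subset[OF _ finA] simp: A'_def A''_def)
      ultimately show ?thesis by (simp add: sum.union_disjoint)
    qed
    moreover have "sum v A = 0"
      by (rule sum_sign_reversing_involution[where h = "\<lambda>(j, d, f). (- j, d, f)"])
        (auto simp: A_def v_def)
    ultimately show ?thesis by simp
  qed
  finally have "(\<Sum>(i, d, e)\<in>Om. - parity_sign d * d) = sum w Eq" by simp
  also have "2 * sum w Eq = (\<Sum>x\<in>{x. x\<^sup>2 = n}. x\<^sup>2)"
  proof (cases "\<exists>N>0. n = N\<^sup>2")
    case True
    then obtain N where N: "N > 0" "n = N\<^sup>2" by blast
    have Eq_D: "i + d = N \<and> odd d \<and> 0 < d \<and> 0 < e \<and> e = d + 2 * i" if "(i, d, e) \<in> Eq" for i d e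
    proof -
      have e: "i\<^sup>2 + d * e = N\<^sup>2" "0 < d" "0 < e" "odd e" "e = d + 2 * i"
        using that N by (auto simp: Eq_def Om_def)
      then have "(i + d)\<^sup>2 = N\<^sup>2" by (simp add: power2_eq_square algebra_simps)
      then have "i + d = N" using e N by (auto simp: power2_eq_iff)
      then show ?thesis using e by auto
    qed
    \<comment> \<open>Here \<open>d\<close> and \<open>e\<close> are odd positive numbers with sum \<open>2 N\<close>; there are \<open>N\<close> such pairs.\<close>
    have "sum w Eq = (\<Sum>k\<in>{0..<N}. N)"
    proof (rule sum.reindex_bij_witness[where j = "\<lambda>(i, d, e). (d - 1) div 2"
            and i = "\<lambda>k. (N - (2 * k + 1), 2 * k + 1, 2 * N - (2 * k + 1))"], goal_cases)
      case (1 a)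
      then show ?case by (cases a) (auto dest!: Eq_D elim!: oddE)
    next
      case (2 a)
      then show ?case by (cases a) (auto dest!: Eq_D elim!: oddE)
    next
      case (3 k) then show ?case by auto
    next
      case (4 k) then show ?case
        by (auto simp: Eq_def Om_def N power2_eq_square algebra_simps)
    next
      case (5 a)
      then show ?case by (cases a) (auto dest!: Eq_D simp: w_def parity_sign_def)
    qed
    also have "\<dots> = N\<^sup>2" using N by (simp add: power2_eq_square)
    finally have "sum w Eq = N\<^sup>2" .
    moreover have "{x. x\<^sup>2 = n} = {N, - N}" using N by (auto simp: power2_eq_iff)
    ultimately show ?thesis using N by simp
  next
    case False
    have "(i + d)\<^sup>2 = n \<and> 0 < i + d" if "(i, d, e) \<in> Eq" for i d e
      using that by (auto simp: Eq_def Om_def power2_eq_square algebra_simps)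
    then have Eq0: "Eq = {}" using False by fastforce
    have "x\<^sup>2 = 0" if "x\<^sup>2 = n" for x
      using that False by (metis linorder_neqE_linordered_idom neg_0_less_iff_less power2_minus zero_power2)
    then have "(\<Sum>x\<in>{x. x\<^sup>2 = n}. x\<^sup>2) = 0" by (intro sum.neutral) auto
    then show ?thesis using Eq0 by simp
  qed
  finally show ?thesis by (simp add: Om_def)
qed

section \<open>Generating functions of graded sets\<close>

definition gen_fun :: "'a set \<Rightarrow> ('a \<Rightarrow> int) \<Rightarrow> ('a \<Rightarrow> int) \<Rightarrow> int fps" where
  "gen_fun X N w = Abs_fps (\<lambda>n. \<Sum>a\<in>{a \<in> X. N a = int n}. w a)"

text \<open>
  Products of the generating functions are only meaningful if each degree is attained finitely often;
  otherwise a coefficient would be the default value 0 of an infinite sum.  Negative degrees would be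
  invisible in the factors but could contribute to the product.
\<close>
definition graded :: "'a set \<Rightarrow> ('a \<Rightarrow> int) \<Rightarrow> bool" where
  "graded X N \<longleftrightarrow> (\<forall>a\<in>X. 0 \<le> N a) \<and> (\<forall>n. finite {a \<in> X. N a = n})"

lemma gen_fun_nth: "gen_fun X N w $ n = (\<Sum>a\<in>{a \<in> X. N a = int n}. w a)"
  by (simp add: gen_fun_def)

lemma gen_fun_mult:
  assumes "graded X N" "graded Y M"
  shows "gen_fun X N w * gen_fun Y M v
       = gen_fun (X \<times> Y) (\<lambda>(a, b). N a + M b) (\<lambda>(a, b). w a * v b)"
proof (rule fps_ext)
  fix n
  define XX where "XX k = {a \<in> X. N a = int k}" for k
  define YY where "YY k = {b \<in> Y. M b = int k}" for k
  have fin: "finite (XX k)" "finite (YY k)" for k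
    using assms by (auto simp: graded_def XX_def YY_def)
  have fin_times: "\<forall>k\<in>{0..n}. finite (XX k \<times> YY (n - k))" using fin by simp
  have split: "{c \<in> X \<times> Y. (case c of (a, b) \<Rightarrow> N a + M b) = int n}
      = (\<Union>k\<in>{0..n}. XX k \<times> YY (n - k))"
  proof (intro equalityI subsetI)
    fix c assume "c \<in> {c \<in> X \<times> Y. (case c of (a, b) \<Rightarrow> N a + M b) = int n}"
    then obtain a b where c: "c = (a, b)" "a \<in> X" "b \<in> Y" "N a + M b = int n" by auto
    have "0 \<le> N a" "0 \<le> M b" using assms c by (auto simp: graded_def)
    then have "nat (N a) \<in> {0..n}" "c \<in> XX (nat (N a)) \<times> YY (n - nat (N a))"
      using c by (auto simp: XX_def YY_def)
    then show "c \<in> (\<Union>k\<in>{0..n}. XX k \<times> YY (n - k))" by blast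
  qed (auto simp: XX_def YY_def)
  have "gen_fun (X \<times> Y) (\<lambda>(a, b). N a + M b) (\<lambda>(a, b). w a * v b) $ n
      = (\<Sum>k\<in>{0..n}. \<Sum>(a, b)\<in>XX k \<times> YY (n - k). w a * v b)"
    unfolding gen_fun_nth split
    by (rule sum.UNION_disjoint[OF _ fin_times]) (auto simp: XX_def YY_def)
  also have "\<dots> = (\<Sum>k\<in>{0..n}. (\<Sum>a\<in>XX k. w a) * (\<Sum>b\<in>YY (n - k). v b))"
    by (simp add: sum_product sum.cartesian_product)
  finally show "(gen_fun X N w * gen_fun Y M v) $ n
      = gen_fun (X \<times> Y) (\<lambda>(a, b). N a + M b) (\<lambda>(a, b). w a * v b) $ n"
    by (simp add: fps_mult_nth gen_fun_nth XX_def YY_def)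
qed

section \<open>Additive statistics of overpartitions\<close>

text \<open>
  A partition with \<open>k\<close> distinct part sizes underlies \<open>2 ^ k\<close> overpartitions, so this is the generating
  function of a statistic of overpartitions that ignores the overlining.
\<close>
definition overpart_gf :: "(nat multiset \<Rightarrow> int) \<Rightarrow> int fps" where
  "overpart_gf f = Abs_fps (\<lambda>n. \<Sum>M\<in>{M. 0 \<notin># M \<and> sum_mset M = n}. 2 ^ card (set_mset M) * f M)"

lemma overpart_gf_nth: "overpart_gf f $ n = (\<Sum>M\<in>{M. 0 \<notin># M \<and> sum_mset M = n}. 2 ^ card (set_mset M) * f M)"
  by (simp add: overpart_gf_def)

lemma finite_partitions: "finite {M :: nat multiset. 0 \<notin># M \<and> sum_mset M = n}"
proof -
  have "{M. 0 \<notin># M \<and> sum_mset M = n} = fst ` overpartitions n"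
    by (force simp: overpartitions_def)
  then show ?thesis using finite_overpartitions[of n] by simp
qed

lemma sum_overpartitions:
  "(\<Sum>l\<in>overpartitions n. f (fst l)) = overpart_gf f $ n" for f :: "nat multiset \<Rightarrow> int"
proof -
  have eq: "overpartitions n = Sigma {M. 0 \<notin># M \<and> sum_mset M = n} (\<lambda>M. Pow (set_mset M))"
    by (auto simp: overpartitions_def)
  have "(\<Sum>l\<in>overpartitions n. f (fst l))
      = (\<Sum>M\<in>{M. 0 \<notin># M \<and> sum_mset M = n}. \<Sum>S\<in>Pow (set_mset M). f M)"
    unfolding eq by (subst sum.Sigma) (auto simp: finite_partitions case_prod_unfold)
  then show ?thesis by (simp add: overpart_gf_nth card_Pow)
qed

lemma overpart_gf_add: "overpart_gf (\<lambda>M. f M + g M) = overpart_gf f + overpart_gf g"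
  by (rule fps_ext) (simp add: overpart_gf_nth sum.distrib algebra_simps)

lemma overpart_gf_cong: "(\<And>M. f M = g M) \<Longrightarrow> overpart_gf f = overpart_gf g"
  by presburger

text \<open>
  If only partitions containing \<open>m\<close> contribute, one copy of \<open>m\<close> can be removed.  When this copy was the
  only one, the number of overlinings is halved, which accounts for the second summand.
\<close>
lemma overpart_gf_add_part:
  assumes m: "0 < m" and f: "\<And>M. m \<notin># M \<Longrightarrow> f M = 0"
  shows "overpart_gf f = fps_X ^ m * (overpart_gf (\<lambda>M. f (add_mset m M))
           + overpart_gf (\<lambda>M. if m \<in># M then 0 else f (add_mset m M)))"
proof (rule fps_ext)
  fix n
  define w :: "nat multiset \<Rightarrow> int" where "w M = 2 ^ card (set_mset M)" for M
  have f': "f M \<noteq> 0 \<Longrightarrow> m \<in># M" for M using f by blast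
  have w_add: "w (add_mset m M) = (if m \<in># M then w M else 2 * w M)" for M
    by (simp add: w_def insert_absorb)
  have "overpart_gf f $ n = (\<Sum>M\<in>{M. 0 \<notin># M \<and> sum_mset M = n \<and> m \<in># M}. w M * f M)"
    unfolding overpart_gf_nth w_def
    by (rule sum.mono_neutral_right) (auto simp: finite_partitions dest: f')
  also have "\<dots> = (fps_X ^ m * overpart_gf (\<lambda>M. f (add_mset m M) + (if m \<in># M then 0 else f (add_mset m M)))) $ n"
  proof (cases "n < m")
    case True
    then have empty: "{M. 0 \<notin># M \<and> sum_mset M = n \<and> m \<in># M} = {}"
      by (auto dest: multi_member_split)
    show ?thesis unfolding empty using True by (simp add: fps_X_power_mult_nth)
  next
    case False
    have "(\<Sum>M\<in>{M. 0 \<notin># M \<and> sum_mset M = n \<and> m \<in># M}. w M * f M)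
        = (\<Sum>M\<in>{M. 0 \<notin># M \<and> sum_mset M = n - m}. w M * (f (add_mset m M) + (if m \<in># M then 0 else f (add_mset m M))))"
      by (rule sum.reindex_bij_witness[where j = "\<lambda>M. M - {#m#}" and i = "add_mset m"])
        (use m False in \<open>auto dest!: multi_member_split simp: w_add\<close>)
    then show ?thesis using False by (simp add: fps_X_power_mult_nth overpart_gf_nth w_def)
  qed
  finally show "overpart_gf f $ n = (fps_X ^ m * (overpart_gf (\<lambda>M. f (add_mset m M))
           + overpart_gf (\<lambda>M. if m \<in># M then 0 else f (add_mset m M)))) $ n"
    by (simp only: overpart_gf_add)
qed

text \<open>
  With \<open>x = q^m\<close>, let \<open>U\<close> and \<open>V\<close> count the overpartitions without and with a part \<open>m\<close>.  Removing a part
  \<open>m\<close> gives \<open>V = x (P + U)\<close> and \<open>C = x (C + P + U)\<close> for the total multiplicity \<open>C\<close> of \<open>m\<close>.  Eliminating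
  \<open>U = P - V\<close> gives \<open>(1 - x^2) C = 2 x P\<close>.
\<close>
lemma overpart_gf_count:
  assumes "0 < m"
  shows "(1 - fps_X ^ (2 * m)) * overpart_gf (\<lambda>M. int (count M m)) = 2 * fps_X ^ m * overpart_gf (\<lambda>_. 1)"
proof -
  let ?x = "fps_X ^ m :: int fps"
  define C where "C = overpart_gf (\<lambda>M. int (count M m))"
  define P where "P = overpart_gf (\<lambda>_. 1)"
  define U where "U = overpart_gf (\<lambda>M. if m \<in># M then 0 else 1)"
  define V where "V = overpart_gf (\<lambda>M. if m \<in># M then 1 else 0)"
  have "P = U + V"
    unfolding P_def U_def V_def overpart_gf_add[symmetric] by (rule overpart_gf_cong) simp
  moreover have "V = ?x * (P + U)"
    unfolding V_def using assms by (subst overpart_gf_add_part[of m]) (simp_all add: P_def U_def cong: if_cong)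
  moreover have "C = ?x * (C + P + U)"
  proof -
    have "C = ?x * (overpart_gf (\<lambda>M. int (count M m) + 1) + overpart_gf (\<lambda>M. if m \<in># M then 0 else int (count M m) + 1))"
      unfolding C_def using assms
      by (subst overpart_gf_add_part[of m]) (simp_all add: count_eq_zero_iff add.commute cong: if_cong)
    also have "(\<lambda>M. if m \<in># M then 0 else int (count M m) + 1) = (\<lambda>M. if m \<in># M then 0 else 1)"
      by (auto simp: fun_eq_iff count_eq_zero_iff)
    finally show ?thesis by (simp add: overpart_gf_add C_def P_def U_def)
  qed
  ultimately have V: "V = P - U" "V = ?x * (P + U)" and "C = ?x * C + V"
    by (simp_all add: algebra_simps)
  then have "C = ?x * (?x * C + V) + V" by simp
  also have "\<dots> = ?x * (?x * C + (P - U)) + ?x * (P + U)" using V by simp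
  finally have "(1 - ?x * ?x) * C = 2 * ?x * P" by (simp add: algebra_simps)
  moreover have "?x * ?x = fps_X ^ (2 * m)" by (simp only: mult_2 power_add)
  ultimately show ?thesis by (simp only: C_def P_def)
qed

text \<open>The expansion of \<open>q^m / (1 - q^(2m))\<close> in powers of \<open>q\<close>.\<close>
definition lambert :: "nat \<Rightarrow> int fps" where
  "lambert m = Abs_fps (\<lambda>n. if m dvd n \<and> odd (n div m) then 1 else 0)"

lemma lambert_eq:
  assumes "0 < m" shows "(1 - fps_X ^ (2 * m)) * lambert m = fps_X ^ m"
proof (rule fps_ext)
  fix n
  have lhs: "((1 - fps_X ^ (2 * m)) * lambert m) $ n
      = lambert m $ n - (if n < 2 * m then 0 else lambert m $ (n - 2 * m))"
    by (simp add: left_diff_distrib fps_X_power_mult_nth)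
  show "((1 - fps_X ^ (2 * m)) * lambert m) $ n = (fps_X ^ m) $ n"
  proof (cases "n < 2 * m")
    case True
    have "m dvd n \<and> odd (n div m) \<longleftrightarrow> n = m"
    proof
      assume n: "m dvd n \<and> odd (n div m)"
      then obtain k where k: "n = m * k" by blast
      then have "odd k" "k < 2" using n True assms by simp_all
      then have "k = 1" by (auto simp: less_2_cases_iff)
      then show "n = m" using k by simp
    qed (use assms in simp)
    then have "lambert m $ n = (if n = m then 1 else 0)" by (simp only: lambert_def fps_nth_Abs_fps)
    then show ?thesis using True lhs by (simp add: fps_X_power_nth)
  next
    case False
    then obtain k where k: "n = 2 * m + k" by (metis le_Suc_ex not_less)
    have "(2 * m + k) div m = 2 + k div m" using div_mult_self3[of m 2 k] assms by simp
    moreover have "m dvd 2 * m + k \<longleftrightarrow> m dvd k" by (simp add: dvd_add_right_iff)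
    ultimately have "lambert m $ n = lambert m $ (n - 2 * m)" by (simp add: lambert_def k)
    then show ?thesis using False lhs assms by (simp add: fps_X_power_nth)
  qed
qed

lemma overpart_gf_count_lambert:
  assumes "0 < m"
  shows "overpart_gf (\<lambda>M. int (count M m)) = 2 * lambert m * overpart_gf (\<lambda>_. 1)"
proof -
  let ?D = "1 - fps_X ^ (2 * m) :: int fps"
  have "?D $ 0 = 1" using assms by simp
  then have "?D \<noteq> 0" by (metis fps_zero_nth zero_neq_one)
  moreover have "?D * overpart_gf (\<lambda>M. int (count M m)) = ?D * (2 * lambert m * overpart_gf (\<lambda>_. 1))"
  proof -
    have "?D * (2 * lambert m * overpart_gf (\<lambda>_. 1)) = 2 * (?D * lambert m) * overpart_gf (\<lambda>_. 1)"
      by (simp only: mult_ac)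
    then show ?thesis by (simp only: overpart_gf_count[OF assms] lambert_eq[OF assms])
  qed
  ultimately show ?thesis by simp
qed

text \<open>The sum over all \<open>m \<ge> 1\<close> of \<open>f m\<close> times \<open>lambert m\<close>, written coefficientwise.\<close>
definition lambert_series :: "(nat \<Rightarrow> int) \<Rightarrow> int fps" where
  "lambert_series f = Abs_fps (\<lambda>n. \<Sum>m\<in>{m \<in> {1..n}. m dvd n \<and> odd (n div m)}. f m)"

lemma lambert_series_nth:
  assumes "k \<le> n"
  shows "lambert_series f $ k = (\<Sum>m\<in>{1..n}. f m * lambert m $ k)"
proof -
  have "m \<le> k" if "m dvd k" "odd (k div m)" for m
  proof -
    have "k \<noteq> 0" using that(2) by (intro notI) simp
    then show ?thesis using that(1) by (simp add: dvd_imp_le)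
  qed
  then have "{m \<in> {1..k}. m dvd k \<and> odd (k div m)} = {m \<in> {1..n}. m dvd k \<and> odd (k div m)}"
    using assms by (simp add: set_eq_iff) (meson order_trans)
  then have "lambert_series f $ k = (\<Sum>m\<in>{1..n}. if m dvd k \<and> odd (k div m) then f m else 0)"
    by (simp only: lambert_series_def fps_nth_Abs_fps) (rule sum.inter_filter, simp)
  also have "\<dots> = (\<Sum>m\<in>{1..n}. f m * lambert m $ k)"
    by (rule sum.cong) (simp_all add: lambert_def)
  finally show ?thesis .
qed

text \<open>
  An additive statistic is the sum over \<open>m\<close> of \<open>f m\<close> times the multiplicity of \<open>m\<close>, and each multiplicity
  contributes \<open>2 f m q^m / (1 - q^(2m))\<close> times \<open>P\<close>.  In degree \<open>n\<close> only the parts up to \<open>n\<close> matter.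
\<close>
lemma overpart_gf_additive:
  "overpart_gf (\<lambda>M. \<Sum>m\<in>#M. f m) = 2 * lambert_series f * overpart_gf (\<lambda>_. 1)"
proof (rule fps_ext)
  fix n
  have fin: "(\<Sum>m\<in>#M. f m) = (\<Sum>m\<in>{1..n}. f m * int (count M m))" if "0 \<notin># M" "sum_mset M \<le> n" for M
    using that
  proof (induction M)
    case (add x M)
    have "(\<Sum>m\<in>{1..n}. f m * int (count (add_mset x M) m))
       = (\<Sum>m\<in>{1..n}. f m * int (count M m) + (if m = x then f m else 0))"
      by (intro sum.cong) (auto simp: algebra_simps)
    also have "\<dots> = (\<Sum>m\<in>{1..n}. f m * int (count M m)) + f x"
      using add.prems by (simp add: sum.distrib)
    finally show ?case using add by simp
  qed simp
  have "overpart_gf (\<lambda>M. \<Sum>m\<in>#M. f m) $ n = (\<Sum>m\<in>{1..n}. f m * overpart_gf (\<lambda>M. int (count M m)) $ n)"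
    by (simp add: overpart_gf_nth fin sum_distrib_left algebra_simps)
      (rule sum.swap)
  also have "\<dots> = (\<Sum>m\<in>{1..n}. f m * (2 * lambert m * overpart_gf (\<lambda>_. 1)) $ n)"
    by (intro sum.cong) (auto simp: overpart_gf_count_lambert)
  also have "\<dots> = (\<Sum>m\<in>{1..n}. \<Sum>k\<in>{0..n}. 2 * (f m * lambert m $ k) * overpart_gf (\<lambda>_. 1) $ (n - k))"
    by (simp only: mult.assoc numeral_fps_const fps_mult_left_const_nth fps_mult_nth[of "lambert _"] sum_distrib_left)
      (simp add: mult_ac)
  also have "\<dots> = (\<Sum>k\<in>{0..n}. 2 * (\<Sum>m\<in>{1..n}. f m * lambert m $ k) * overpart_gf (\<lambda>_. 1) $ (n - k))"
    by (subst sum.swap) (simp add: sum_distrib_left sum_distrib_right)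
  also have "\<dots> = (\<Sum>k\<in>{0..n}. 2 * lambert_series f $ k * overpart_gf (\<lambda>_. 1) $ (n - k))"
    by (intro sum.cong) (auto simp: lambert_series_nth)
  also have "\<dots> = (2 * lambert_series f * overpart_gf (\<lambda>_. 1)) $ n"
    by (simp only: mult.assoc numeral_fps_const fps_mult_left_const_nth fps_mult_nth[of "lambert_series _"] sum_distrib_left)
  finally show "overpart_gf (\<lambda>M. \<Sum>m\<in>#M. f m) $ n = (2 * lambert_series f * overpart_gf (\<lambda>_. 1)) $ n" .
qed

lemma SOME_bar_eq:
  "Abs_fps SOME_bar = 2 * lambert_series (\<lambda>m. - parity_sign (int m) * int m) * overpart_gf (\<lambda>_. 1)"
proof -
  have *: "int (sum_mset (filter_mset odd M)) - int (sum_mset (filter_mset even M))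
    = (\<Sum>m\<in>#M. - parity_sign (int m) * int m)" for M
    by (induction M) (auto simp: parity_sign_def)
  have "Abs_fps SOME_bar = overpart_gf (\<lambda>M. \<Sum>m\<in>#M. - parity_sign (int m) * int m)"
    by (rule fps_ext) (simp only: fps_nth_Abs_fps SOME_bar_def odd_parts_sum_def even_parts_sum_def *
      flip: sum_overpartitions)
  then show ?thesis by (simp only: overpart_gf_additive)
qed

text \<open>
  The sum of all parts is additive and equals the degree, so the same principle computes the
  logarithmic derivative of the overpartition generating function.
\<close>
lemma X_deriv_overpart_gf: "fps_X * fps_deriv (overpart_gf (\<lambda>_. 1)) = 2 * lambert_series int * overpart_gf (\<lambda>_. 1)"
proof -
  have *: "(\<Sum>m\<in>#M. int m) = int (sum_mset M)" for M by (induction M) auto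
  have "fps_X * fps_deriv (overpart_gf (\<lambda>_. 1)) = overpart_gf (\<lambda>M. \<Sum>m\<in>#M. int m)"
  proof (rule fps_ext)
    fix n
    have "(fps_X * fps_deriv (overpart_gf (\<lambda>_. 1))) $ n = int n * overpart_gf (\<lambda>_. 1) $ n"
      by (cases n) simp_all
    also have "\<dots> = overpart_gf (\<lambda>M. \<Sum>m\<in>#M. int m) $ n"
      unfolding overpart_gf_nth sum_distrib_left *
      by (rule sum.cong) (auto simp del: of_nat_sum_mset)
    finally show "(fps_X * fps_deriv (overpart_gf (\<lambda>_. 1))) $ n = overpart_gf (\<lambda>M. \<Sum>m\<in>#M. int m) $ n" .
  qed
  then show ?thesis by (simp only: overpart_gf_additive)
qed

section \<open>Theta series\<close>

text \<open>In degree \<open>n\<close>, a divisor \<open>m\<close> with odd cofactor corresponds to the pair \<open>(m, n div m)\<close>.\<close>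
lemma lambert_series_eq_gen_fun:
  "lambert_series (\<lambda>m. g (int m))
     = gen_fun {(d, e). 0 < d \<and> 0 < e \<and> odd e} (\<lambda>(d, e). d * e) (\<lambda>(d, e). g d)"
proof (rule fps_ext)
  fix n
  show "lambert_series (\<lambda>m. g (int m)) $ n
     = gen_fun {(d, e). 0 < d \<and> 0 < e \<and> odd e} (\<lambda>(d, e). d * e) (\<lambda>(d, e). g d) $ n"
    unfolding lambert_series_def gen_fun_nth fps_nth_Abs_fps
  proof (rule sum.reindex_bij_witness[where j = "\<lambda>m. (int m, int (n div m))" and i = "\<lambda>(d, e). nat d"], goal_cases)
    case (1 m) then show ?case by simp
  next
    case (2 m)
    then obtain k where k: "n = m * k" "0 < m" by auto
    then have "odd k" using 2 by simp
    then show ?case using k by (simp add: odd_pos)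
  next
    case (3 b)
    then obtain d e where b: "b = (d, e)" "0 < d" "0 < e" "d * e = int n" by auto
    then have "n = nat d * nat e" by (simp flip: nat_mult_distrib)
    then show ?case using b by simp
  next
    case (4 b)
    then obtain d e where b: "b = (d, e)" "0 < d" "0 < e" "odd e" "d * e = int n" by auto
    then have n: "n = nat d * nat e" by (simp flip: nat_mult_distrib)
    moreover have "odd (nat e)" using b by (simp add: even_nat_iff)
    moreover have "nat d \<le> n" using b n by simp
    ultimately show ?case using b by simp
  next
    case (5 m) then show ?case by simp
  qed
qed

lemma graded_divisor_pairs: "graded {(d, e). 0 < d \<and> 0 < e \<and> odd e} (\<lambda>(d, e). d * e)"
  unfolding graded_def
proof (intro conjI ballI allI)
  fix n :: int
  have "{a \<in> {(d, e). 0 < d \<and> 0 < e \<and> odd e}. (case a of (d, e) \<Rightarrow> d * e) = n}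
      \<subseteq> snd ` {(i, d, e). i\<^sup>2 + d * e = n \<and> 0 < d \<and> 0 < e}"
    by (force simp: image_iff)
  then show "finite {a \<in> {(d, e). 0 < d \<and> 0 < e \<and> odd e}. (case a of (d, e) \<Rightarrow> d * e) = n}"
    by (rule finite_subset) (simp add: finite_square_plus_product)
qed auto

lemma graded_squares:
  assumes "0 < c" shows "graded UNIV (\<lambda>x :: int. c * x\<^sup>2)"
  unfolding graded_def
proof (intro conjI ballI allI)
  fix n :: int
  have "\<bar>x\<bar> \<le> n" if "c * x\<^sup>2 = n" for x
  proof -
    have "\<bar>x\<bar> \<le> x\<^sup>2" by (rule abs_le_square)
    also have "\<dots> \<le> c * x\<^sup>2" using assms mult_right_mono[of 1 c "x\<^sup>2"] by simp
    finally show ?thesis using that by simp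
  qed
  then have "{x \<in> UNIV. c * x\<^sup>2 = n} \<subseteq> {- n..n}" by (fastforce simp: abs_le_iff)
  then show "finite {x \<in> UNIV. c * x\<^sup>2 = n}" by (rule finite_subset) simp
qed (use assms in simp)

definition theta_series :: "int \<Rightarrow> (int \<Rightarrow> int) \<Rightarrow> int fps" where
  "theta_series c w = gen_fun UNIV (\<lambda>x. c * x\<^sup>2) w"

lemma theta_series_nth: "theta_series c w $ n = (\<Sum>x\<in>{x. c * x\<^sup>2 = int n}. w x)"
  by (simp add: theta_series_def gen_fun_nth)

lemma theta_series_mult:
  assumes "0 < c"
  shows "(theta_series c w * theta_series c v) $ n = (\<Sum>(x, y)\<in>{(x, y). c * x\<^sup>2 + c * y\<^sup>2 = int n}. w x * v y)"
  unfolding theta_series_def gen_fun_mult[OF graded_squares[OF assms] graded_squares[OF assms]] gen_fun_nth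
  by (rule sum.cong) auto

abbreviation phi :: "int fps" where "phi \<equiv> theta_series 1 (\<lambda>_. 1)"
abbreviation phi_neg :: "int fps" where "phi_neg \<equiv> theta_series 1 parity_sign"
abbreviation psi :: "int fps" where "psi \<equiv> theta_series 2 parity_sign"

lemma X_deriv_nth: "(fps_X * fps_deriv F) $ n = of_nat n * F $ n" for F :: "int fps"
  by (cases n) simp_all

text \<open>
  The coefficient of \<open>q^n\<close> on the left is a sum over \<open>i^2 + d e = n\<close> with \<open>e\<close> odd, to which
  \<open>liouville_square_identity\<close> applies.
\<close>
lemma lambert_series_mult_phi:
  "2 * lambert_series (\<lambda>m. - parity_sign (int m) * int m) * phi = fps_X * fps_deriv phi"
proof (rule fps_ext)
  fix n
  let ?X = "{(d, e). 0 < d \<and> 0 < e \<and> odd e} :: (int \<times> int) set"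
  have "lambert_series (\<lambda>m. - parity_sign (int m) * int m)
      = gen_fun ?X (\<lambda>(d, e). d * e) (\<lambda>(d, e). - parity_sign d * d)"
    using lambert_series_eq_gen_fun[of "\<lambda>d. - parity_sign d * d"] by simp
  then have "(phi * lambert_series (\<lambda>m. - parity_sign (int m) * int m)) $ n
      = (\<Sum>(i, d, e)\<in>{(i, d, e). i\<^sup>2 + d * e = int n \<and> 0 < d \<and> 0 < e \<and> odd e}. - parity_sign d * d)"
    unfolding theta_series_def
    by (simp only: gen_fun_mult[OF graded_squares[OF zero_less_one] graded_divisor_pairs] gen_fun_nth)
      (rule sum.cong, auto)
  then have "2 * (phi * lambert_series (\<lambda>m. - parity_sign (int m) * int m)) $ n
      = (\<Sum>x\<in>{x. x\<^sup>2 = int n}. x\<^sup>2)"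
    using liouville_square_identity[of "int n"] by simp
  also have "\<dots> = (fps_X * fps_deriv phi) $ n"
    by (simp add: X_deriv_nth theta_series_nth)
  finally show "(2 * lambert_series (\<lambda>m. - parity_sign (int m) * int m) * phi) $ n = (fps_X * fps_deriv phi) $ n"
    by (simp only: mult.assoc mult.commute[of phi] numeral_fps_const fps_mult_left_const_nth)
qed

text \<open>The substitution \<open>q \<mapsto> -q\<close>.\<close>
definition twist :: "int fps \<Rightarrow> int fps" where
  "twist F = Abs_fps (\<lambda>n. (- 1) ^ n * F $ n)"

lemma twist_mult: "twist (F * G) = twist F * twist G"
  by (rule fps_ext)
    (auto simp: twist_def fps_mult_nth sum_distrib_left intro!: sum.cong
      simp flip: power_add)

lemma parity_sign_power: "parity_sign (int n) = (- 1) ^ n"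
  by (simp add: parity_sign_def)

lemma twist_phi: "twist phi = phi_neg"
proof (rule fps_ext)
  fix n
  have "(- 1) ^ n = parity_sign x" if "x\<^sup>2 = int n" for x
  proof -
    have "parity_sign x = parity_sign (x\<^sup>2)" by (simp add: parity_sign_def)
    then show ?thesis by (simp only: that parity_sign_power)
  qed
  then show "twist phi $ n = phi_neg $ n"
    unfolding twist_def theta_series_nth fps_nth_Abs_fps sum_distrib_left by (intro sum.cong) auto
qed

lemma twist_lambert_series:
  "twist (lambert_series (\<lambda>m. - parity_sign (int m) * int m)) = - lambert_series int"
proof (rule fps_ext)
  fix n
  have "(- 1) ^ n * parity_sign (int m) = 1" if "m dvd n" "odd (n div m)" for m
  proof -
    have "even n \<longleftrightarrow> even m" using that by (metis dvd_mult_div_cancel even_mult_iff)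
    then show ?thesis by (simp add: parity_sign_def)
  qed
  then have summand: "(- 1) ^ n * (- parity_sign (int m) * int m) = - int m" if "m dvd n" "odd (n div m)" for m
    using that by (simp flip: mult.assoc)
  then show "twist (lambert_series (\<lambda>m. - parity_sign (int m) * int m)) $ n = (- lambert_series int) $ n"
    unfolding twist_def lambert_series_def fps_neg_nth fps_nth_Abs_fps sum_distrib_left sum_negf[symmetric]
    by (intro sum.cong[OF refl] summand) simp_all
qed

lemma X_deriv_phi_neg: "fps_X * fps_deriv phi_neg = - (2 * lambert_series int * phi_neg)"
proof -
  have twist_2: "twist 2 = 2"
    by (rule fps_ext) (simp add: twist_def fps_numeral_nth)
  have "fps_X * fps_deriv phi_neg = twist (fps_X * fps_deriv phi)"
    by (rule fps_ext) (simp only: twist_def twist_phi[symmetric] fps_nth_Abs_fps X_deriv_nth mult_ac)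
  also have "\<dots> = 2 * (- lambert_series int) * phi_neg"
    by (simp only: lambert_series_mult_phi[symmetric] twist_mult twist_2 twist_lambert_series twist_phi)
  finally show ?thesis by simp
qed

text \<open>
  The logarithmic derivatives of \<open>P(q)\<close> and \<open>\<phi>(-q)\<close> are opposite, so the product is constant.
\<close>
lemma overpart_gf_mult_phi_neg: "overpart_gf (\<lambda>_. 1) * phi_neg = 1"
proof -
  let ?P = "overpart_gf (\<lambda>_. 1)"
  have "fps_X * fps_deriv (?P * phi_neg) = fps_X * fps_deriv ?P * phi_neg + ?P * (fps_X * fps_deriv phi_neg)"
    by (simp add: algebra_simps)
  also have "\<dots> = 0" unfolding X_deriv_phi_neg X_deriv_overpart_gf by (simp add: algebra_simps)
  finally have "fps_deriv (?P * phi_neg) = 0" by (simp del: fps_deriv_mult)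
  then have "?P * phi_neg = fps_const ((?P * phi_neg) $ 0)" by (simp only: fps_deriv_eq_0_iff)
  moreover have "{M :: nat multiset. 0 \<notin># M \<and> sum_mset M = 0} = {{#}}"
    by auto (metis multiset_nonemptyE)
  then have "?P $ 0 = 1" by (simp add: overpart_gf_nth)
  moreover have "phi_neg $ 0 = 1" by (simp add: theta_series_nth parity_sign_def)
  ultimately show ?thesis by (simp only: fps_mult_nth_0 mult_1 fps_const_1_eq_1)
qed

text \<open>
  The left-hand side is the sum of \<open>(-1)^y q^(x^2 + y^2)\<close>.  Exchanging \<open>x\<close> and \<open>y\<close> cancels the pairs of
  opposite parity; the remaining ones are \<open>(u + v, u - v)\<close> with \<open>x^2 + y^2 = 2 u^2 + 2 v^2\<close>.
\<close>
lemma phi_mult_phi_neg: "phi * phi_neg = psi\<^sup>2"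
proof (rule fps_ext)
  fix n
  define X where "X = {(x :: int, y). x\<^sup>2 + y\<^sup>2 = int n}"
  define E where "E = {(x, y) \<in> X. even (x + y)}"
  define O' where "O' = {(x, y) \<in> X. odd (x + y)}"
  have "X \<subseteq> {- int n..int n} \<times> {- int n..int n}"
  proof clarify
    fix x y assume "(x, y) \<in> X"
    then have "x\<^sup>2 + y\<^sup>2 = int n" by (simp add: X_def)
    then have "\<bar>x\<bar> \<le> int n" "\<bar>y\<bar> \<le> int n"
      using abs_le_square[of x] abs_le_square[of y] zero_le_power2[of x] zero_le_power2[of y] by linarith+
    then show "x \<in> {- int n..int n} \<and> y \<in> {- int n..int n}" by auto
  qed
  then have "finite X" by (rule finite_subset) simp
  moreover have "X = E \<union> O'" "E \<inter> O' = {}" by (auto simp: E_def O'_def)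
  ultimately have "(\<Sum>(x, y)\<in>X. parity_sign y) = (\<Sum>(x, y)\<in>E. parity_sign y) + (\<Sum>(x, y)\<in>O'. parity_sign y)"
    by (simp add: sum.union_disjoint)
  also have "(\<Sum>(x, y)\<in>O'. parity_sign y) = 0"
    by (rule sum_sign_reversing_involution[where h = prod.swap])
      (auto simp: O'_def X_def parity_sign_def algebra_simps)
  also have "(\<Sum>(x, y)\<in>E. parity_sign y)
     = (\<Sum>(u, v)\<in>{(u, v). 2 * u\<^sup>2 + 2 * v\<^sup>2 = int n}. parity_sign u * parity_sign v)"
  proof (rule sum.reindex_bij_witness[where i = "\<lambda>(u, v). (u + v, u - v)"
        and j = "\<lambda>(x, y). ((x + y) div 2, (x - y) div 2)"])
    have coords: "\<exists>u v. a = (u + v, u - v) \<and> 2 * u\<^sup>2 + 2 * v\<^sup>2 = int n" if a: "a \<in> E" for a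
    proof -
      obtain x y where xy: "a = (x, y)" "x\<^sup>2 + y\<^sup>2 = int n" "even (x + y)"
        using a by (auto simp: E_def X_def)
      then obtain u where "x + y = 2 * u" by blast
      then have "x = u + (x - u)" "y = u - (x - u)" by simp_all
      moreover have "(u + v)\<^sup>2 + (u - v)\<^sup>2 = 2 * u\<^sup>2 + 2 * v\<^sup>2" for v
        by (simp add: power2_eq_square algebra_simps)
      ultimately show ?thesis using xy by metis
    qed
    fix a assume "a \<in> E"
    from coords[OF this] obtain u v where a: "a = (u + v, u - v)" "2 * u\<^sup>2 + 2 * v\<^sup>2 = int n" by blast
    then show "(case case a of (x, y) \<Rightarrow> ((x + y) div 2, (x - y) div 2) of (u, v) \<Rightarrow> (u + v, u - v)) = a"
      and "(case a of (x, y) \<Rightarrow> ((x + y) div 2, (x - y) div 2)) \<in> {(u, v). 2 * u\<^sup>2 + 2 * v\<^sup>2 = int n}"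
      and "(case case a of (x, y) \<Rightarrow> ((x + y) div 2, (x - y) div 2) of (u, v) \<Rightarrow> parity_sign u * parity_sign v)
        = (case a of (x, y) \<Rightarrow> parity_sign y)"
      by (auto simp: parity_sign_def)
  next
    fix b assume "b \<in> {(u, v). 2 * u\<^sup>2 + 2 * v\<^sup>2 = int n}"
    then obtain u v where b: "b = (u, v)" "2 * u\<^sup>2 + 2 * v\<^sup>2 = int n" by blast
    then show "(case case b of (u, v) \<Rightarrow> (u + v, u - v) of (x, y) \<Rightarrow> ((x + y) div 2, (x - y) div 2)) = b"
      and "(case b of (u, v) \<Rightarrow> (u + v, u - v)) \<in> E"
      by (auto simp: E_def X_def power2_eq_square algebra_simps)
  qed
  finally have "(\<Sum>(x, y)\<in>X. parity_sign y) = \<dots>" by simp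
  then show "(phi * phi_neg) $ n = (psi\<^sup>2) $ n"
    by (simp add: theta_series_mult power2_eq_square[of psi] X_def)
qed

lemma SOME_bar_mult_psi: "Abs_fps SOME_bar * psi\<^sup>2 = fps_X * fps_deriv phi"
proof -
  let ?L = "lambert_series (\<lambda>m. - parity_sign (int m) * int m)"
  have "Abs_fps SOME_bar * psi\<^sup>2 = (2 * ?L * phi) * (overpart_gf (\<lambda>_. 1) * phi_neg)"
    unfolding SOME_bar_eq phi_mult_phi_neg[symmetric] by (simp only: mult_ac)
  then show ?thesis by (simp only: overpart_gf_mult_phi_neg lambert_series_mult_phi mult_1_right)
qed

section \<open>Congruences modulo 3\<close>

definition supported_mod :: "int \<Rightarrow> nat set \<Rightarrow> int fps \<Rightarrow> bool" where
  "supported_mod p A F \<longleftrightarrow> (\<forall>n. n \<notin> A \<longrightarrow> p dvd F $ n)"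

lemma supported_mod_mult:
  assumes "supported_mod p A F" "supported_mod p B G"
  shows "supported_mod p {a + b | a b. a \<in> A \<and> b \<in> B} (F * G)"
  unfolding supported_mod_def
proof (intro allI impI)
  fix n assume n: "n \<notin> {a + b | a b. a \<in> A \<and> b \<in> B}"
  have "p dvd F $ k * G $ (n - k)" if "k \<in> {0..n}" for k
  proof -
    have "k \<notin> A \<or> n - k \<notin> B" using n that by force
    then show ?thesis using assms by (auto simp: supported_mod_def)
  qed
  then show "p dvd (F * G) $ n" unfolding fps_mult_nth by (rule dvd_sum)
qed

lemma supported_mod_mono: "supported_mod p A F \<Longrightarrow> A \<subseteq> B \<Longrightarrow> supported_mod p B F"
  by (auto simp: supported_mod_def)

lemma cube_cong_3: "[a ^ 3 = a] (mod 3)" for a :: int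
proof -
  have "a mod 3 = 0 \<or> a mod 3 = 1 \<or> a mod 3 = 2" by presburger
  then have "(a mod 3) ^ 3 mod 3 = a mod 3" by auto
  then show ?thesis by (simp add: cong_def power_mod)
qed

text \<open>
  The Frobenius congruence \<open>F(q)^3 \<equiv> F(q^3)\<close>.  Splitting off the constant term, \<open>F = c + q G\<close>, gives
  \<open>F^3 \<equiv> c^3 + q^3 G^3\<close>, and \<open>c^3 \<equiv> c\<close>; so the coefficients of degree \<open>n\<close> reduce to those of \<open>G\<close> in degree
  \<open>n - 3\<close>.
\<close>
lemma fps_cube_nth_cong_3:
  fixes F :: "int fps"
  shows "[(F ^ 3) $ n = (if 3 dvd n then F $ (n div 3) else 0)] (mod 3)"
proof (induction n arbitrary: F rule: less_induct)
  case (less n)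
  define c where "c = F $ 0"
  define G where "G = fps_shift 1 F"
  have F: "F = fps_const c + fps_X * G"
    by (rule fps_ext) (simp add: c_def G_def fps_X_mult_nth)
  have "F ^ 3 = fps_const (c ^ 3) + fps_X ^ 3 * G ^ 3
      + fps_const 3 * (fps_const c * fps_X * G * (fps_const c + fps_X * G))"
    unfolding F by (simp add: power3_eq_cube algebra_simps flip: fps_const_mult numeral_fps_const)
  then have eq: "(F ^ 3) $ n = (if n = 0 then c ^ 3 else 0) + (if n < 3 then 0 else (G ^ 3) $ (n - 3))
      + 3 * (fps_const c * fps_X * G * (fps_const c + fps_X * G)) $ n"
    by (simp add: fps_X_power_mult_nth)
  have step: "[(F ^ 3) $ n = (if n = 0 then c ^ 3 else 0) + (if n < 3 then 0 else (G ^ 3) $ (n - 3))] (mod 3)"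
    unfolding eq by (simp add: cong_def)
  show ?case
  proof (cases "n < 3")
    case True
    have "n = 0" if "3 dvd n" using True that by (auto elim: dvdE)
    then show ?thesis using step True cube_cong_3[of c] by (auto simp: c_def intro: cong_trans)
  next
    case False
    have "[(G ^ 3) $ (n - 3) = (if 3 dvd n - 3 then G $ ((n - 3) div 3) else 0)] (mod 3)"
      using False by (intro less.IH) simp
    moreover have "G $ ((n - 3) div 3) = F $ (n div 3)"
      using False by (simp add: G_def le_div_geq)
    ultimately show ?thesis using step False by (auto simp: dvd_minus_self intro: cong_trans)
  qed
qed

lemma supported_mod_cube: "supported_mod 3 {3 * k | k. F $ k \<noteq> 0} (F ^ 3)"
  unfolding supported_mod_def
proof (intro allI impI)
  fix n assume n: "n \<notin> {3 * k | k. F $ k \<noteq> 0}"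
  then have "(if 3 dvd n then F $ (n div 3) else 0) = 0" by auto
  then show "3 dvd (F ^ 3) $ n" using fps_cube_nth_cong_3[of F n] by (metis cong_0_iff)
qed

lemma square_mod_3: "x\<^sup>2 mod 3 \<noteq> 2" for x :: int
proof -
  have "x mod 3 = 0 \<or> x mod 3 = 1 \<or> x mod 3 = 2" by presburger
  then have "(x mod 3)\<^sup>2 mod 3 \<noteq> 2" by auto
  then show ?thesis by (simp add: power_mod)
qed

text \<open>
  Applying Frobenius twice, \<open>\<psi>^9 \<equiv> \<psi>(q^9)\<close>.  The latter is exactly the part of \<open>\<psi>\<close> with exponents
  divisible by 3: if 3 divides \<open>2 x^2\<close>, then \<open>x = 3 y\<close>, and \<open>x\<close> and \<open>y\<close> have the same parity.  All other
  exponents of \<open>\<psi>\<close> are 2 modulo 3.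
\<close>
lemma psi_minus_psi_power_9: "supported_mod 3 {n. n mod 3 = 2} (psi - psi ^ 9)"
  unfolding supported_mod_def
proof (intro allI impI)
  fix n :: nat assume n: "n \<notin> {n. n mod 3 = 2}"
  have p9: "psi ^ 9 = (psi ^ 3) ^ 3" by (simp flip: power_mult)
  have c: "[(psi ^ 9) $ n = (if 3 dvd n then (psi ^ 3) $ (n div 3) else 0)] (mod 3)"
    unfolding p9 by (rule fps_cube_nth_cong_3)
  have "[(psi ^ 9) $ n = psi $ n] (mod 3)"
  proof (cases "3 dvd n")
    case False
    moreover have "n mod 3 \<noteq> 2" using n by simp
    ultimately have "int n mod 3 = 1" by presburger
    then have "2 * x\<^sup>2 \<noteq> int n" for x using square_mod_3[of x] by presburger
    then have "psi $ n = 0" by (simp add: theta_series_nth)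
    then show ?thesis using c False by simp
  next
    case True
    then obtain k where k: "n = 3 * k" by blast
    have root: "\<exists>y. x = 3 * y \<and> int k = 6 * y\<^sup>2" if x: "2 * x\<^sup>2 = int n" for x
    proof -
      have "3 dvd x\<^sup>2" using x k by presburger
      then have "3 dvd x" by (simp add: prime_dvd_power_int_iff)
      then obtain y where "x = 3 * y" by blast
      then show ?thesis using x k by (simp add: power2_eq_square)
    qed
    have "psi $ n = (if 3 dvd k then psi $ (k div 3) else 0)"
    proof (cases "3 dvd k")
      case True
      then obtain m where m: "k = 3 * m" by blast
      have "psi $ n = psi $ m" unfolding theta_series_nth
      proof (rule sum.reindex_bij_witness[where i = "\<lambda>x. 3 * x" and j = "\<lambda>x. x div 3"])
        fix x assume "x \<in> {x. 2 * x\<^sup>2 = int n}"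
        then obtain y where "x = 3 * y" "int k = 6 * y\<^sup>2" using root by blast
        then show "3 * (x div 3) = x" "x div 3 \<in> {x. 2 * x\<^sup>2 = int m}"
          "parity_sign (x div 3) = parity_sign x"
          using m by (simp_all add: parity_sign_def)
      qed (use k m in auto)
      then show ?thesis using m by simp
    next
      case False
      have "2 * x\<^sup>2 \<noteq> int n" for x
      proof
        assume "2 * x\<^sup>2 = int n"
        then obtain y where "int k = 6 * y\<^sup>2" using root by blast
        then show False using False by presburger
      qed
      then show ?thesis using False by (simp add: theta_series_nth)
    qed
    then show ?thesis using c k fps_cube_nth_cong_3[of psi k] by (auto intro: cong_trans)
  qed
  then show "3 dvd (psi - psi ^ 9) $ n" by (simp add: cong_iff_dvd_diff cong_sym_eq dvd_diff_commute)
qed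

text \<open>The coefficient of \<open>q^(x^2)\<close> has the factor \<open>x^2\<close>, so exponents divisible by 3 disappear.\<close>
lemma X_deriv_phi_supported:
  "supported_mod 3 {n. n mod 3 = 1 \<and> (\<exists>x :: int. int n = x\<^sup>2)} (fps_X * fps_deriv phi)"
  unfolding supported_mod_def
proof (intro allI impI)
  fix n :: nat assume n: "n \<notin> {n. n mod 3 = 1 \<and> (\<exists>x :: int. int n = x\<^sup>2)}"
  show "3 dvd (fps_X * fps_deriv phi) $ n"
  proof (cases "\<exists>x :: int. x\<^sup>2 = int n")
    case True
    then obtain x :: int where x: "x\<^sup>2 = int n" by blast
    then have "n mod 3 \<noteq> 1" using n by (auto dest: sym)
    then have "3 dvd int n" using x square_mod_3[of x] by presburger
    then show ?thesis by (simp add: X_deriv_nth)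
  next
    case False
    then show ?thesis by (simp add: X_deriv_nth theta_series_nth)
  qed
qed

lemma psi_power_6_supported: "supported_mod 3 {n. \<exists>u v :: int. int n = 6 * (u\<^sup>2 + v\<^sup>2)} (psi ^ 6)"
proof -
  have p: "psi ^ 6 = (psi\<^sup>2) ^ 3" by (simp flip: power_mult)
  have "\<exists>u v. int k = 2 * u\<^sup>2 + 2 * v\<^sup>2" if "(psi\<^sup>2) $ k \<noteq> 0" for k
  proof (rule ccontr)
    assume "\<not> ?thesis"
    then have "{(u, v). 2 * u\<^sup>2 + 2 * v\<^sup>2 = int k} = {}" by (auto dest: sym)
    then have "(psi\<^sup>2) $ k = 0" unfolding power2_eq_square[of psi] by (subst theta_series_mult) simp_all
    then show False using that by simp
  qed
  then have "{3 * k | k. (psi\<^sup>2) $ k \<noteq> 0} \<subseteq> {n. \<exists>u v :: int. int n = 6 * (u\<^sup>2 + v\<^sup>2)}" by fastforce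
  then show ?thesis unfolding p using supported_mod_cube supported_mod_mono by blast
qed

text \<open>
  An odd \<open>x\<close> would have to satisfy \<open>6 (u^2 + v^2) \<equiv> 2\<close> modulo 8, so \<open>u^2 + v^2 \<equiv> 3\<close> modulo 4, which is impossible
  for a sum of two squares; an even \<open>x\<close> fails by parity.
\<close>
lemma square_plus_6_squares_mod_8: "(x\<^sup>2 + 6 * (u\<^sup>2 + v\<^sup>2)) mod 8 \<noteq> 3" for x u v :: int
proof -
  have sq: "a\<^sup>2 mod 8 = 0 \<or> a\<^sup>2 mod 8 = 1 \<or> a\<^sup>2 mod 8 = 4" for a :: int
  proof -
    have "a mod 8 \<in> {0, 1, 2, 3, 4, 5, 6, 7}" by simp presburger
    then have "(a mod 8)\<^sup>2 mod 8 \<in> {0, 1, 4}" by auto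
    then show ?thesis by (simp add: power_mod)
  qed
  have "[x\<^sup>2 + 6 * (u\<^sup>2 + v\<^sup>2) = x\<^sup>2 mod 8 + 6 * (u\<^sup>2 mod 8 + v\<^sup>2 mod 8)] (mod 8)"
    by (intro cong_add cong_mult cong_refl) (simp_all add: cong_def)
  then show ?thesis unfolding cong_def using sq[of x] sq[of u] sq[of v] by (elim disjE) simp_all
qed

theorem theorem15:
  fixes n :: nat
  shows "[SOME_bar (3 * n + 2) = 0] (mod 3) \<and> [SOME_bar (24 * n + 19) = 0] (mod 3)"
proof -
  let ?S = "Abs_fps SOME_bar" and ?T = "fps_X * fps_deriv phi"
  have "psi $ 0 = 1" by (simp add: theta_series_nth parity_sign_def)
  then have "1 * psi $ 0 = 1" by simp
  then obtain Q where Q: "Q * psi = 1" using fps_left_inverse by blast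
  define G where "G = ?T * (psi - psi ^ 9) * Q ^ 3"
  have "?S = ?S * psi\<^sup>2 * Q\<^sup>2"
    using Q by (simp add: mult.assoc flip: power_mult_distrib add: mult.commute[of psi])
  also have "\<dots> = ?T * Q\<^sup>2" by (simp only: SOME_bar_mult_psi)
  also have "Q\<^sup>2 = (psi - psi ^ 9) * Q ^ 3 + psi ^ 6"
  proof -
    have "psi * Q ^ 3 = (Q * psi) * Q\<^sup>2" by (simp add: eval_nat_numeral mult_ac)
    moreover have "psi ^ 9 * Q ^ 3 = (Q * psi) ^ 3 * psi ^ 6" by (simp add: eval_nat_numeral mult_ac)
    ultimately show ?thesis using Q by (simp add: left_diff_distrib)
  qed
  finally have S: "?S = G + ?T * psi ^ 6" by (simp add: G_def distrib_left mult.assoc)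
  have "supported_mod 3 {n. n mod 3 = 0} (Q ^ 3)"
    by (rule supported_mod_mono[OF supported_mod_cube]) auto
  from supported_mod_mult[OF supported_mod_mult[OF X_deriv_phi_supported psi_minus_psi_power_9] this]
  have "supported_mod 3 {n. n mod 3 = 0} G" unfolding G_def
    by (rule supported_mod_mono) (auto, presburger)
  then have G: "3 dvd G $ k" if "k mod 3 \<noteq> 0" for k using that by (simp add: supported_mod_def)
  have "supported_mod 3 {n. n mod 3 = 1 \<and> int n mod 8 \<noteq> 3} (?T * psi ^ 6)"
  proof (rule supported_mod_mono[OF supported_mod_mult[OF X_deriv_phi_supported psi_power_6_supported]], safe)
    fix a b :: nat and x u v :: int
    assume a: "a mod 3 = 1" "int a = x\<^sup>2" and b: "int b = 6 * (u\<^sup>2 + v\<^sup>2)"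
    show "(a + b) mod 3 = 1" using a(1) b by presburger
    assume "int (a + b) mod 8 = 3"
    then show False using square_plus_6_squares_mod_8[of x u v] a b by simp
  qed
  then have T: "3 dvd (?T * psi ^ 6) $ k" if "\<not> (k mod 3 = 1 \<and> int k mod 8 \<noteq> 3)" for k
    using that by (auto simp: supported_mod_def)
  have "3 dvd ?S $ k" if "k mod 3 = 2 \<or> k mod 3 = 1 \<and> int k mod 8 = 3" for k
    unfolding S fps_add_nth by (rule dvd_add) (use that in \<open>auto intro!: G T\<close>)
  then have "3 dvd SOME_bar k" if "k mod 3 = 2 \<or> k mod 3 = 1 \<and> int k mod 8 = 3" for k
    using that by simp
  moreover have "(3 * n + 2) mod 3 = 2" "(24 * n + 19) mod 3 = 1" "int (24 * n + 19) mod 8 = 3"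
    by presburger+
  ultimately show ?thesis unfolding cong_0_iff by blast
qed

end
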